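(* Let $A$ be a C*-algebra and let $V\subset A$ be a closed linear subspace such that $V^*VV^*V\subset V^*V$ (products in $\operatorname{Max}A$). Then $V\subset VV^*V$.
   Context: For a C*-algebra $A$, $\operatorname{Max}A$ is the set of closed linear subspaces of $A$, ordered by inclusion, with $V^*=\{a^*: a\in V\}$ and product $VW=\overline{\operatorname{span}}\{ab: a\in V,\ b\in W\}$ (closed linear span). This product is associative; all products of subspaces in the claim are taken in this sense. *)

theory Defs
  imports "HOL-Analysis.Analysis"
begin

text \<open>
  C*-algebras are not assumed unital, commutative or nonzero. The real scalar multiplication
  inherited from the class \<^class>\<open>real_normed_algebra\<close> is the restriction of the complex one.
\<close>

class cstar_algebra = real_normed_algebra + banach +
  fixes scaleC :: "complex \<Rightarrow> 'a \<Rightarrow> 'a" (infixr \<open>*\<^sub>C\<close> 75)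
    and adj :: "'a \<Rightarrow> 'a"
  assumes scaleC_add_right: "c *\<^sub>C (x + y) = c *\<^sub>C x + c *\<^sub>C y"
    and scaleC_add_left: "(c + d) *\<^sub>C x = c *\<^sub>C x + d *\<^sub>C x"
    and scaleC_scaleC: "c *\<^sub>C d *\<^sub>C x = (c * d) *\<^sub>C x"
    and scaleC_one: "1 *\<^sub>C x = x"
    and scaleR_scaleC: "r *\<^sub>R x = complex_of_real r *\<^sub>C x"
    and mult_scaleC_left: "c *\<^sub>C x * y = c *\<^sub>C (x * y)"
    and mult_scaleC_right: "x * c *\<^sub>C y = c *\<^sub>C (x * y)"
    and norm_scaleC: "norm (c *\<^sub>C x) = cmod c * norm x"
    and adj_adj: "adj (adj x) = x"
    and adj_add: "adj (x + y) = adj x + adj y"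
    and adj_scaleC: "adj (c *\<^sub>C x) = cnj c *\<^sub>C adj x"
    and adj_mult: "adj (x * y) = adj y * adj x"
    and cstar_identity: "norm (adj x * x) = (norm x)\<^sup>2"

global_interpretation complex_vector: vector_space "scaleC :: complex \<Rightarrow> 'a \<Rightarrow> 'a :: cstar_algebra"
  defines csubspace = complex_vector.subspace
    and cspan = complex_vector.span
  by unfold_locales (simp_all add: scaleC_add_right scaleC_add_left scaleC_scaleC scaleC_one)

definition Max_alg :: "'a :: cstar_algebra set set" where
  "Max_alg = {V. csubspace V \<and> closed V}"

definition adj_set :: "'a :: cstar_algebra set \<Rightarrow> 'a set" (\<open>_\<^sup>\<star>\<close> [1000] 1000) where
  "V\<^sup>\<star> = {adj a |a. a \<in> V}"

definition mult_set :: "'a :: cstar_algebra set \<Rightarrow> 'a set \<Rightarrow> 'a set" (infixl \<open>\<odot>\<close> 70) where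
  "V \<odot> W = closure (cspan {a * b |a b. a \<in> V \<and> b \<in> W})"

end

theory Submission
  imports Defs
begin

text \<open>
  Put \<open>B = V\<^sup>\<star> \<odot> V\<close>. The hypothesis makes the closed subspace \<open>B\<close> multiplicatively closed, and
  \<open>v * B \<subseteq> V \<odot> V\<^sup>\<star> \<odot> V\<close> for \<open>v \<in> V\<close>. So it suffices to approximate \<open>v\<close> by elements of \<open>v * B\<close>,
  knowing only that the self-adjoint element \<open>a = adj v * v\<close> lies in \<open>B\<close>
  (\<open>right_approximation\<close>).

  Elements \<open>g = 1 + h\<close> with \<open>h \<in> B\<close> live in the unitization; multiplication by \<open>g\<close> is written
  \<open>x + h * x\<close> or \<open>x + x * h\<close>, which avoids adjoining a unit. If \<open>g\<close> is a contraction, then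
  \<open>norm (v g)\<^sup>2 = norm (adj g a g) \<le> norm (a g)\<close>, and \<open>v g = v + v * h\<close> is the error of the
  approximation \<open>- (v * h)\<close> of \<open>v\<close>. Hence contractions \<open>g \<in> 1 + B\<close> with \<open>a g\<close> arbitrarily small are
  wanted (\<open>selfadjoint_approximate_unit\<close>).

  These come from a mean ergodic argument, which replaces continuous functional calculus and uses
  no spectral theory. After scaling, \<open>u = \<i> c a\<close> is skew-adjoint of norm below \<open>1\<close>, and its
  Cayley transform \<open>E = (1 + u) (1 - u)\<^sup>-\<^sup>1 = 1 + e\<close> is unitary with \<open>2 u = (1 - u) (E - 1)\<close>.
  The Abel mean \<open>g = (1 - r) (1 - r E)\<^sup>-\<^sup>1\<close> of the powers of \<open>E\<close> is a contraction, and
  \<open>(E - 1) g = (1 / r - 1) (g - 1)\<close> tends to \<open>0\<close> as \<open>r \<rightarrow> 1\<close>; hence so do \<open>u g\<close> and \<open>a g\<close>.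
  Both \<open>e\<close> and \<open>g - 1\<close> are fixed points of contractive affine maps of \<open>B\<close>, so they exist in \<open>B\<close> by
  Banach's theorem.
\<close>

section \<open>Norm and involution\<close>

lemma adj_zero: "adj (0 :: 'a :: cstar_algebra) = 0"
  using adj_add[of "0 :: 'a" 0] by simp

lemma adj_minus: "adj (- x) = - adj (x :: 'a :: cstar_algebra)"
  using adj_add[of x "- x"] by (simp add: adj_zero eq_neg_iff_add_eq_0 add.commute)

lemma norm_adj: "norm (adj x) = norm (x :: 'a :: cstar_algebra)"
proof -
  have le: "norm y \<le> norm (adj y)" for y :: 'a
  proof (cases "y = 0")
    case False
    have "norm y * norm y \<le> norm (adj y) * norm y"
      using norm_mult_ineq[of "adj y" y] by (simp add: cstar_identity power2_eq_square)
    then show ?thesis using False by simp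
  qed (simp add: adj_zero)
  show ?thesis using le[of x] le[of "adj x"] by (simp add: adj_adj)
qed

section \<open>Closed subspaces generated by products\<close>

lemma csubspace_scaleR: "csubspace S \<Longrightarrow> x \<in> S \<Longrightarrow> r *\<^sub>R x \<in> S"
  by (simp add: scaleR_scaleC complex_vector.subspace_scale)

lemma continuous_scaleC:
  "continuous_on UNIV (\<lambda>x :: 'a :: cstar_algebra. c *\<^sub>C x)"
proof -
  have "bounded_linear (\<lambda>x :: 'a. c *\<^sub>C x)"
    by (rule bounded_linear_intro[where K = "cmod c"])
      (simp_all add: scaleC_add_right scaleR_scaleC scaleC_scaleC norm_scaleC mult.commute)
  then show ?thesis by (rule linear_continuous_on)
qed

lemma csubspace_closure:
  fixes S :: "'a :: cstar_algebra set"
  assumes S: "csubspace S"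
  shows "csubspace (closure S)"
proof (rule complex_vector.subspaceI)
  show "0 \<in> closure S"
    using complex_vector.subspace_0[OF S] closure_subset by blast
next
  fix x y assume "x \<in> closure S" "y \<in> closure S"
  then obtain f g where f: "\<And>n :: nat. f n \<in> S" "f \<longlonglongrightarrow> x"
    and g: "\<And>n :: nat. g n \<in> S" "g \<longlonglongrightarrow> y"
    unfolding closure_sequential by blast
  have "(\<lambda>n. f n + g n) \<longlonglongrightarrow> x + y" using f(2) g(2) by (rule tendsto_add)
  moreover have "f n + g n \<in> S" for n
    using complex_vector.subspace_add[OF S] f(1) g(1) by blast
  ultimately show "x + y \<in> closure S"
    unfolding closure_sequential by (intro exI[of _ "\<lambda>n. f n + g n"]) simp
next
  fix c x assume x: "x \<in> closure S"
  have "(\<lambda>x. c *\<^sub>C x) ` closure S \<subseteq> closure S"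
  proof (rule image_closure_subset)
    show "continuous_on (closure S) (\<lambda>x. c *\<^sub>C x)"
      using continuous_scaleC continuous_on_subset by blast
    show "(\<lambda>x. c *\<^sub>C x) ` S \<subseteq> closure S"
      using complex_vector.subspace_scale[OF S] closure_subset by blast
  qed simp
  then show "c *\<^sub>C x \<in> closure S" using x by blast
qed

lemma csubspace_mult_set: "csubspace (V \<odot> W)"
  unfolding mult_set_def
  by (rule csubspace_closure) (rule complex_vector.subspace_span)

lemma closed_mult_set: "closed (V \<odot> W)"
  unfolding mult_set_def by simp

lemma mult_in_mult_set: "a \<in> V \<Longrightarrow> b \<in> W \<Longrightarrow> a * b \<in> V \<odot> W"
  unfolding mult_set_def
  by (rule subsetD[OF closure_subset], rule complex_vector.span_base) blast

lemma mult_set_least: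
  assumes "csubspace S" and "closed S"
    and "\<And>a b. a \<in> V \<Longrightarrow> b \<in> W \<Longrightarrow> a * b \<in> S"
  shows "V \<odot> W \<subseteq> S"
  unfolding mult_set_def
  using assms by (intro closure_minimal complex_vector.span_minimal) blast+

lemma left_mult_mult_set_subset:
  fixes x :: "'a :: cstar_algebra"
  assumes S: "csubspace S" and "closed S"
    and gen: "\<And>a b. a \<in> V \<Longrightarrow> b \<in> W \<Longrightarrow> x * (a * b) \<in> S"
    and y: "y \<in> V \<odot> W"
  shows "x * y \<in> S"
proof -
  have "V \<odot> W \<subseteq> {y. x * y \<in> S}"
  proof (rule mult_set_least)
    show "csubspace {y. x * y \<in> S}"
      using S by (intro complex_vector.subspaceI)
        (simp_all add: complex_vector.subspace_0 complex_vector.subspace_add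
          complex_vector.subspace_scale distrib_left mult_scaleC_right)
    have "closed ((\<lambda>y. x * y) -` S)"
      using \<open>closed S\<close> by (intro closed_vimage continuous_intros)
    then show "closed {y. x * y \<in> S}" by (simp add: vimage_def)
  qed (simp add: gen)
  then show ?thesis using y by blast
qed

section \<open>Contractions of the form 1 + h\<close>

lemma unitary_isometry:
  fixes e x :: "'a :: cstar_algebra"
  assumes "e + adj e + adj e * e = 0"
  shows "norm (x + e * x) = norm x"
proof -
  have "adj (x + e * x) * (x + e * x)
      = adj x * x + adj x * (e + adj e + adj e * e) * x"
    by (simp add: adj_add adj_mult algebra_simps)
  then have "(norm (x + e * x))\<^sup>2 = (norm x)\<^sup>2"
    using assms by (simp flip: cstar_identity)
  then show ?thesis by simp
qed

text \<open>
  Write \<open>g = 1 + h\<close>. The C*-identity carries contractivity from the left to the right: apply the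
  hypothesis to \<open>y = adj (x g)\<close>: then \<open>norm (x g)\<^sup>2 = norm (x (g y)) \<le> norm x * norm (x g)\<close>.
\<close>

lemma right_contraction:
  fixes h :: "'a :: cstar_algebra"
  assumes left: "\<And>x. norm (x + h * x) \<le> norm x"
  shows "norm (x + x * h) \<le> norm x"
proof (cases "x + x * h = 0")
  case False
  define y where "y = adj (x + x * h)"
  have "norm (x + x * h) * norm (x + x * h) = norm (adj y * y)"
    unfolding cstar_identity by (simp add: y_def norm_adj power2_eq_square)
  also have "adj y * y = x * (y + h * y)"
    by (simp add: y_def adj_adj algebra_simps)
  also have "norm \<dots> \<le> norm x * norm (y + h * y)" by (rule norm_mult_ineq)
  also have "\<dots> \<le> norm x * norm y" by (intro mult_left_mono left) simp
  also have "\<dots> = norm x * norm (x + x * h)" by (simp add: y_def norm_adj)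
  finally show ?thesis using False by simp
qed simp

lemma adj_contraction:
  fixes h :: "'a :: cstar_algebra"
  assumes "\<And>x. norm (x + h * x) \<le> norm x"
  shows "norm (x + adj h * x) \<le> norm x"
proof -
  have "adj (adj x + adj x * h) = x + adj h * x"
    by (simp add: adj_add adj_mult adj_adj)
  then show ?thesis
    using right_contraction[OF assms, of "adj x"] by (metis norm_adj)
qed

text \<open>
  In the unitization this is \<open>norm h \<le> norm g + norm 1\<close>; without a unit it is tested on \<open>h\<close>
  itself, through \<open>adj h * h = adj g * h - h\<close>.
\<close>

lemma contraction_norm_le_2:
  fixes h :: "'a :: cstar_algebra"
  assumes "\<And>x. norm (x + h * x) \<le> norm x"
  shows "norm h \<le> 2"
proof (cases "h = 0")
  case False
  have "norm h * norm h = norm ((h + adj h * h) - h)"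
    by (simp add: cstar_identity power2_eq_square)
  also have "\<dots> \<le> norm (h + adj h * h) + norm h" by (rule norm_triangle_ineq4)
  also have "\<dots> \<le> 2 * norm h" using adj_contraction[OF assms, of h] by simp
  finally show ?thesis using False by simp
qed simp

section \<open>Cayley transform and its resolvent\<close>

text \<open>
  The equation for \<open>e\<close> says \<open>(1 - u) (1 + e) = 1 + u\<close>, so \<open>1 + e\<close> is the Cayley transform of \<open>u\<close>.
\<close>

lemma cayley_exists:
  fixes u :: "'a :: cstar_algebra"
  assumes B: "csubspace B" "closed B" and mult: "\<And>x y. x \<in> B \<Longrightarrow> y \<in> B \<Longrightarrow> x * y \<in> B"
    and u: "u \<in> B" "norm u < 1"
  obtains e where "e \<in> B" "2 *\<^sub>R u + u * e = e"
proof -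
  have "\<exists>!e\<in>B. 2 *\<^sub>R u + u * e = e"
  proof (rule Banach_fix)
    show "complete B" using B(2) by (simp add: complete_eq_closed)
    show "B \<noteq> {}" using u(1) by blast
    show "0 \<le> norm u" by simp
    show "norm u < 1" by (rule u(2))
    show "(\<lambda>e. 2 *\<^sub>R u + u * e) ` B \<subseteq> B"
      using B(1) u(1) by (auto intro!: complex_vector.subspace_add csubspace_scaleR mult)
    show "dist (2 *\<^sub>R u + u * x) (2 *\<^sub>R u + u * y) \<le> norm u * dist x y" for x y
      using norm_mult_ineq[of u "x - y"] by (simp add: dist_norm algebra_simps)
  qed
  then show thesis using that by metis
qed

text \<open>
  With \<open>f = adj e\<close>, the adjoint equation is \<open>(1 + f) (1 + u) = 1 - u\<close>. Evaluating
  \<open>f * u * e\<close> through either equation and comparing gives twice the claim.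
\<close>

lemma cayley_unitary:
  fixes u e :: "'a :: cstar_algebra"
  assumes skew: "adj u = - u" and e: "2 *\<^sub>R u + u * e = e"
  shows "e + adj e + adj e * e = 0"
proof -
  define f where "f = adj e"
  have ue: "u * e = e - u - u"
    using e by (simp add: eq_diff_eq scaleR_2 add_ac)
  have "adj (u * e) = f - adj u - adj u"
    unfolding ue f_def by (simp only: diff_conv_add_uminus adj_add adj_minus)
  then have "- (f * u) = f + u + u" by (simp add: adj_mult skew f_def)
  then have "f * u = - (f + u + u)" by (metis minus_minus)
  then have fu: "f * u = - f - u - u" by simp
  have "f * (u * e) = (f * u) * e" by (simp add: mult.assoc)
  then have "2 *\<^sub>R (e + f + f * e) = 0"
    by (simp add: ue fu algebra_simps scaleR_2)
  then show ?thesis by (simp add: f_def)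
qed

text \<open>
  For \<open>E = 1 + e\<close> and \<open>g = 1 + h\<close> the fixed point equation reads \<open>g = (1 - r) + r E g\<close>. Since
  left multiplication by \<open>E\<close> is isometric, the right-hand side is \<open>r\<close>-Lipschitz in \<open>g\<close>, and
  \<open>norm (g x) \<le> (1 - r) * norm x + r * norm (g x)\<close> shows that \<open>g\<close> is a contraction.
\<close>

lemma abel_mean_exists:
  fixes e :: "'a :: cstar_algebra"
  assumes B: "csubspace B" "closed B" and mult: "\<And>x y. x \<in> B \<Longrightarrow> y \<in> B \<Longrightarrow> x * y \<in> B"
    and e: "e \<in> B" and iso: "\<And>x. norm (x + e * x) = norm x"
    and r: "0 \<le> r" "r < 1"
  obtains h where "h \<in> B" "r *\<^sub>R (e + h + e * h) = h"
    "\<And>x. norm (x + h * x) \<le> norm x"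
proof -
  have "\<exists>!h\<in>B. r *\<^sub>R (e + h + e * h) = h"
  proof (rule Banach_fix)
    show "complete B" using B(2) by (simp add: complete_eq_closed)
    show "B \<noteq> {}" using e by blast
    show "0 \<le> r" "r < 1" by (rule r)+
    show "(\<lambda>h. r *\<^sub>R (e + h + e * h)) ` B \<subseteq> B"
      using B(1) e by (auto intro!: complex_vector.subspace_add csubspace_scaleR mult)
    show "dist (r *\<^sub>R (e + x + e * x)) (r *\<^sub>R (e + y + e * y)) \<le> r * dist x y" for x y
    proof -
      have "r *\<^sub>R (e + x + e * x) - r *\<^sub>R (e + y + e * y) = r *\<^sub>R ((x - y) + e * (x - y))"
        by (simp add: algebra_simps)
      then show ?thesis using r(1) iso[of "x - y"] by (simp add: dist_norm)
    qed
  qed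
  then obtain h where h: "h \<in> B" "r *\<^sub>R (e + h + e * h) = h" by metis
  have "norm (x + h * x) \<le> norm x" for x
  proof -
    define y where "y = x + h * x"
    have "h * x = r *\<^sub>R (e + h + e * h) * x" using h(2) by simp
    then have "y = (1 - r) *\<^sub>R x + r *\<^sub>R (y + e * y)"
      by (simp add: y_def algebra_simps)
    then have "norm y \<le> norm ((1 - r) *\<^sub>R x) + norm (r *\<^sub>R (y + e * y))"
      by (metis norm_triangle_ineq)
    then have "norm y \<le> (1 - r) * norm x + r * norm y"
      using r by (simp add: iso)
    then have "(1 - r) * norm y \<le> (1 - r) * norm x" by (simp add: algebra_simps)
    then show ?thesis using r(2) by (simp add: y_def)
  qed
  with h that show thesis by blast
qed

section \<open>Approximate units\<close>

text \<open>
  The element \<open>- h\<close> acts as a right unit for \<open>a\<close> up to \<open>\<epsilon>\<close>; it comes from the Abel mean of the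
  Cayley transform \<open>1 + e\<close> of a multiple of \<open>\<i> a\<close>, for \<open>r\<close> close to \<open>1\<close>.
\<close>

lemma selfadjoint_approximate_unit:
  fixes a :: "'a :: cstar_algebra"
  assumes B: "csubspace B" "closed B" and mult: "\<And>x y. x \<in> B \<Longrightarrow> y \<in> B \<Longrightarrow> x * y \<in> B"
    and a: "a \<in> B" "adj a = a" and \<epsilon>: "0 < \<epsilon>"
  obtains h where "h \<in> B" "\<And>x. norm (x + h * x) \<le> norm x" "norm (a + a * h) \<le> \<epsilon>"
proof -
  define c where "c = 1 / (1 + norm a)"
  have c: "0 < c" by (simp add: c_def add_pos_nonneg)
  define u where "u = (\<i> * complex_of_real c) *\<^sub>C a"
  have u: "u \<in> B" unfolding u_def using B(1) a(1) by (rule complex_vector.subspace_scale)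
  have "norm a < 1 + norm a" by simp
  then have small: "norm u < 1"
    using c by (simp add: u_def norm_scaleC norm_mult) (simp add: c_def)
  have "adj u = (- (\<i> * complex_of_real c)) *\<^sub>C a"
    unfolding u_def adj_scaleC by (simp add: a(2))
  then have skew: "adj u = - u" by (simp add: u_def complex_vector.scale_minus_left)
  obtain e where e: "e \<in> B" "2 *\<^sub>R u + u * e = e"
    using cayley_exists[OF B mult u small] by blast
  have iso: "norm (x + e * x) = norm x" for x
    by (rule unitary_isometry[OF cayley_unitary[OF skew e(2)]])
  \<comment> \<open>The identity \<open>e + e * h = \<delta> *\<^sub>R h\<close> will give \<open>norm (u + u * h) \<le> 2 * \<delta>\<close>, where \<open>\<delta> = 1 / r - 1\<close>,
    and \<open>norm (u + u * h) = c * norm (a + a * h)\<close>; this dictates \<open>\<delta>\<close>.\<close>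
  define \<delta> where "\<delta> = c * \<epsilon> / 2"
  have \<delta>: "0 < \<delta>" using c \<epsilon> by (simp add: \<delta>_def)
  define r where "r = 1 / (1 + \<delta>)"
  have r: "0 \<le> r" "r < 1" "(1 + \<delta>) * r = 1"
    using \<delta> by (simp_all add: r_def)
  obtain h where h: "h \<in> B" "r *\<^sub>R (e + h + e * h) = h"
    and contr: "\<And>x. norm (x + h * x) \<le> norm x"
    using abel_mean_exists[OF B mult e(1) iso r(1,2)] by blast
  have "(1 + \<delta>) *\<^sub>R h = ((1 + \<delta>) * r) *\<^sub>R (e + h + e * h)"
    using h(2) by (metis scaleR_scaleR)
  then have "(1 + \<delta>) *\<^sub>R h = e + h + e * h" unfolding r(3) by simp
  then have eh: "e + e * h = \<delta> *\<^sub>R h" by (simp add: algebra_simps)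
  \<comment> \<open>Multiplying by \<open>1 - u\<close> turns smallness of \<open>(E - 1) g\<close>, for \<open>E = 1 + e\<close> and \<open>g = 1 + h\<close>,
    into smallness of \<open>u g\<close>.\<close>
  have two_u: "2 *\<^sub>R u = e - u * e" using e(2) by (simp add: eq_diff_eq)
  have "2 *\<^sub>R (u + u * h) = 2 *\<^sub>R u + 2 *\<^sub>R u * h" by (simp add: algebra_simps)
  also have "\<dots> = (e + e * h) - u * (e + e * h)"
    unfolding two_u by (simp add: algebra_simps)
  finally have "2 *\<^sub>R (u + u * h) = \<delta> *\<^sub>R (h - u * h)"
    unfolding eh by (simp add: algebra_simps)
  then have "2 * norm (u + u * h) = \<delta> * norm (h - u * h)"
    using \<delta> by (metis abs_of_pos norm_scaleR zero_less_numeral)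
  moreover have "norm (h - u * h) \<le> 4"
  proof -
    have "norm (h - u * h) \<le> norm h + norm u * norm h"
      using norm_triangle_ineq4[of h "u * h"] norm_mult_ineq[of u h] by linarith
    also have "\<dots> \<le> 2 + 1 * 2"
      using contraction_norm_le_2[OF contr] small by (intro add_mono mult_mono) auto
    finally show ?thesis by simp
  qed
  then have "\<delta> * norm (h - u * h) \<le> \<delta> * 4"
    using \<delta> by (intro mult_left_mono) simp_all
  ultimately have "norm (u + u * h) \<le> 2 * \<delta>" by linarith
  then have "norm (u + u * h) \<le> c * \<epsilon>" by (simp add: \<delta>_def)
  moreover have "u + u * h = (\<i> * complex_of_real c) *\<^sub>C (a + a * h)"
    by (simp add: u_def scaleC_add_right mult_scaleC_left)
  ultimately have "c * norm (a + a * h) \<le> c * \<epsilon>"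
    using c by (simp add: norm_scaleC norm_mult)
  then have "norm (a + a * h) \<le> \<epsilon>" using c by simp
  with h(1) contr that show thesis by blast
qed

text \<open>
  The C*-identity transfers the approximation from \<open>a = adj v * v\<close> to \<open>v\<close>: for a contraction
  \<open>g = 1 + h\<close>, \<open>norm (v g)\<^sup>2 = norm (adj g (a g)) \<le> norm (a g)\<close>.
\<close>

lemma right_approximation:
  fixes v :: "'a :: cstar_algebra"
  assumes B: "csubspace B" "closed B" and mult: "\<And>x y. x \<in> B \<Longrightarrow> y \<in> B \<Longrightarrow> x * y \<in> B"
    and v: "adj v * v \<in> B"
  shows "v \<in> closure {v * b |b. b \<in> B}"
  unfolding closure_approachable
proof (intro allI impI)
  fix \<epsilon> :: real assume \<epsilon>: "0 < \<epsilon>"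
  define a where "a = adj v * v"
  have "adj a = a" by (simp add: a_def adj_mult adj_adj)
  moreover have "a \<in> B" using v by (simp add: a_def)
  moreover have "0 < (\<epsilon> / 2)\<^sup>2" using \<epsilon> by simp
  ultimately obtain h where h: "h \<in> B" and contr: "\<And>x. norm (x + h * x) \<le> norm x"
    and small: "norm (a + a * h) \<le> (\<epsilon> / 2)\<^sup>2"
    using selfadjoint_approximate_unit[OF B mult] by metis
  have "(norm (v + v * h))\<^sup>2 = norm (adj (v + v * h) * (v + v * h))"
    by (simp add: cstar_identity)
  also have "adj (v + v * h) * (v + v * h) = (a + a * h) + adj h * (a + a * h)"
    by (simp add: a_def adj_add adj_mult algebra_simps)
  also have "norm \<dots> \<le> norm (a + a * h)" by (rule adj_contraction[OF contr])
  finally have "(norm (v + v * h))\<^sup>2 \<le> (\<epsilon> / 2)\<^sup>2" using small by linarith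
  then have "norm (v + v * h) \<le> \<epsilon> / 2" by (rule power2_le_imp_le) (use \<epsilon> in linarith)
  moreover have "dist (v * (- h)) v = norm (v + v * h)"
    by (simp add: dist_norm norm_minus_commute[of _ v])
  moreover have "- h \<in> B" using B(1) h by (rule complex_vector.subspace_neg)
  then have "v * (- h) \<in> {v * b |b. b \<in> B}" by blast
  ultimately show "\<exists>y\<in>{v * b |b. b \<in> B}. dist y v < \<epsilon>"
    using \<epsilon> by (intro bexI[of _ "v * (- h)"]) simp_all
qed

theorem theorem2p1:
  fixes V :: "'a :: cstar_algebra set"
  assumes "V \<in> Max_alg"
    and "V\<^sup>\<star> \<odot> V \<odot> V\<^sup>\<star> \<odot> V \<subseteq> V\<^sup>\<star> \<odot> V"
  shows "V \<subseteq> V \<odot> V\<^sup>\<star> \<odot> V"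
proof
  fix v assume v: "v \<in> V"
  define B where "B = V\<^sup>\<star> \<odot> V"
  have B: "csubspace B" "closed B"
    by (simp_all add: B_def csubspace_mult_set closed_mult_set)
  have mult: "x * y \<in> B" if x: "x \<in> B" and y: "y \<in> B" for x y
  proof (rule left_mult_mult_set_subset[OF B _ y[unfolded B_def]])
    fix p q assume "p \<in> V\<^sup>\<star>" "q \<in> V"
    then have "x * p * q \<in> B \<odot> V\<^sup>\<star> \<odot> V" using x by (intro mult_in_mult_set)
    then show "x * (p * q) \<in> B" using assms(2) by (auto simp: B_def mult.assoc)
  qed
  have "adj v * v \<in> B"
    unfolding B_def using v by (intro mult_in_mult_set) (auto simp: adj_set_def)
  then have "v \<in> closure {v * b |b. b \<in> B}" using right_approximation[OF B mult] by blast
  also have "closure {v * b |b. b \<in> B} \<subseteq> V \<odot> V\<^sup>\<star> \<odot> V"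
  proof (rule closure_minimal)
    have "v * b \<in> V \<odot> V\<^sup>\<star> \<odot> V" if b: "b \<in> B" for b
    proof (rule left_mult_mult_set_subset[OF csubspace_mult_set closed_mult_set _ b[unfolded B_def]])
      fix p q assume "p \<in> V\<^sup>\<star>" "q \<in> V"
      then have "v * p * q \<in> V \<odot> V\<^sup>\<star> \<odot> V" using v by (intro mult_in_mult_set)
      then show "v * (p * q) \<in> V \<odot> V\<^sup>\<star> \<odot> V" by (simp add: mult.assoc)
    qed
    then show "{v * b |b. b \<in> B} \<subseteq> V \<odot> V\<^sup>\<star> \<odot> V" by blast
  qed (rule closed_mult_set)
  finally show "v \<in> V \<odot> V\<^sup>\<star> \<odot> V" .
qed

end
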